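(* Let $f,g,h,h_1,\dots,h_n:M\to K$ be functions satisfying $$f(xy)=g(x)h(y)+\sum_{j=1}^{n}g_j(x)h_j(y)\qquad\text{for all }x,y\in M,$$ with $f\neq0$. If the set $\{g,\mu_1,\mu_2,\dots,\mu_m\}$ is linearly dependent over $K$, then there exist a unique $q\in\{1,\dots,n\}$ and constants $a,b,c,d\in K$ and $c_j\in K$ for $j\in\{1,\dots,n\}\setminus\{q\}$, with $c\neq d$ and $(a,b)\neq(0,0)$, such that: - if $m_q-n_q=1$, then $$f=(d-c)\left(b\,b_{n_q}\mu_{n_q}-a\,b_{m_q}\mu_{m_q}\right),$$ $$g=d\,b_{n_q}\mu_{n_q}+c\,b_{m_q}\mu_{m_q}+\sum_{j=1,\,j\neq q}^{n}c_jg_j,$$ $$h=a\mu_{m_q}+b\mu_{n_q},\qquad h_q=-da\,\mu_{m_q}-cb\,\mu_{n_q},$$ $$h_j=-c_ja\,\mu_{m_q}-c_jb\,\mu_{n_q}\quad\text{for all }j\in\{1,\dots,n\}\setminus\{q\};$$ - if $m_q-n_q\geq2$, then for some $k\in\{n_q,\dots,m_q\}$, and with $a\neq0$, $$f=a(c-d)b_k\mu_k,\qquad g=dg_q+(c-d)b_k\mu_k+\sum_{j=1,\,j\neq q}^{n}c_jg_j,$$ $$h=a\mu_k,\qquad h_q=-da\,\mu_k,\qquad h_j=-c_ja\,\mu_k\quad\text{for all }j\in\{1,\dots,n\}\setminus\{q\}.$$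
   Context: $M$ is a monoid (a semigroup with neutral element $e$, not necessarily commutative) and $K$ is a field. A multiplicative function is a map $\mu:M\to K$ with $\mu(xy)=\mu(x)\mu(y)$ for all $x,y\in M$; "nonzero" means not identically zero. Let $n\geq2$ be an integer. Let $\mu_1,\dots,\mu_m:M\to K$ be distinct nonzero multiplicative functions, and let $b_1,\dots,b_m\in K$ all be nonzero. The index set $\{1,\dots,m\}$ is partitioned into $n$ consecutive intervals $\{n_j,\dots,m_j\}$, $j=1,\dots,n$, with $n_1=1$, $m_j=n_{j+1}-1$ for $1\leq j\leq n-1$, $m_n=m$, and $m_j-n_j\geq1$ for every $j$ (each interval has at least two elements). For $j=1,\dots,n$ define $g_j=\sum_{i=n_j}^{m_j}b_i\mu_i$. Linear dependence of a set of functions listed as $\{g,\mu_1,\dots,\mu_m\}$ means linear dependence of the family $(g,\mu_1,\dots,\mu_m)$ in the $K$-vector space of functions $M\to K$. *)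

theory Defs
  imports Main
begin

definition multiplicative :: "('m::monoid_mult \<Rightarrow> 'k::field) \<Rightarrow> bool" where
  "multiplicative \<mu> \<longleftrightarrow> (\<forall>x y. \<mu> (x * y) = \<mu> x * \<mu> y)"

(* The library's dependent is a predicate on sets of vectors; a family with a repeated
   member is dependent here, even though its range may be an independent set. *)
definition dependent_family :: "'i set \<Rightarrow> ('i \<Rightarrow> 'm \<Rightarrow> 'k::field) \<Rightarrow> bool" where
  "dependent_family I v \<longleftrightarrow>
     (\<exists>J c. finite J \<and> J \<subseteq> I \<and> (\<exists>i\<in>J. c i \<noteq> 0) \<and> (\<forall>x. (\<Sum>i\<in>J. c i * v i x) = 0))"

end

theory Submission
  imports Defs "HOL-Library.Disjoint_Sets"
begin

text \<open>
  Distinct nonzero multiplicative functions are linearly independent (Dedekind), so the dependence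
  of \<open>g, \<mu>\<^sub>1, \<dots>, \<mu>\<^sub>m\<close> puts \<open>g\<close> into the span of the \<open>\<mu>\<^sub>i\<close>; write \<open>g = \<Sum>i. l\<^sub>i \<beta>\<^sub>i \<mu>\<^sub>i\<close>. The equation
  becomes \<open>f (x y) = \<Sum>i. \<beta>\<^sub>i \<mu>\<^sub>i(x) (l\<^sub>i h(y) + h\<^sub>j(y))\<close>, where \<open>j\<close> is the interval of \<open>i\<close>. Putting \<open>y = 1\<close>
  shows that \<open>f\<close> is in the span as well, \<open>f = \<Sum>i. p\<^sub>i \<beta>\<^sub>i \<mu>\<^sub>i\<close>. Expanding \<open>f (x y)\<close> multiplicatively
  and comparing coefficients of \<open>\<mu>\<^sub>i(x)\<close> yields \<open>l\<^sub>i h + h\<^sub>j = p\<^sub>i \<mu>\<^sub>i\<close>. This is \<open>block_relations\<close>.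

  Two indices \<open>i, i'\<close> of one interval eliminate \<open>h\<^sub>j\<close>: \<open>(l\<^sub>i - l\<^sub>i') h = p\<^sub>i \<mu>\<^sub>i - p\<^sub>i' \<mu>\<^sub>i'\<close>. As \<open>f \<noteq> 0\<close>, some
  \<open>p\<^sub>k\<close> is nonzero, say with \<open>k\<close> in the interval \<open>q\<close>. Then \<open>h\<close> is a combination of \<open>\<mu>\<^sub>k\<close> and \<open>\<mu>\<^sub>i'\<close> for every
  other \<open>i'\<close> in that interval, with nonzero coefficient at \<open>\<mu>\<^sub>k\<close>. In every interval other than \<open>q\<close>
  independence now forces all \<open>p\<^sub>i\<close> to vanish and \<open>l\<^sub>i\<close> to be a constant \<open>c\<^sub>j\<close>, whence \<open>h\<^sub>j = - c\<^sub>j h\<close>. This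
  is \<open>concentrated_on_one_block\<close>. An interval \<open>q\<close> with two elements gives the first family of solutions;
  if it has a third element, then comparing two choices of \<open>i'\<close> leaves only the multiple of \<open>\<mu>\<^sub>k\<close> in \<open>h\<close>,
  which is the second family. Finally \<open>q\<close> is unique because it is the only interval with \<open>h\<close> in the span of its \<open>\<mu>\<^sub>i\<close>.
\<close>

section \<open>Independence of characters\<close>

definition distinct_characters :: "'i set \<Rightarrow> ('i \<Rightarrow> 'm::monoid_mult \<Rightarrow> 'k::field) \<Rightarrow> bool" where
  "distinct_characters I \<mu> \<longleftrightarrow>
     finite I \<and> inj_on \<mu> I \<and> (\<forall>i\<in>I. multiplicative (\<mu> i) \<and> \<mu> i \<noteq> (\<lambda>x. 0))"

text \<open>
  Dedekind's argument: translating a vanishing combination by \<open>y\<close> and subtracting \<open>\<mu> k y\<close> times the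
  original removes \<open>\<mu> k\<close> and multiplies the coefficient of \<open>\<mu> i\<close> by \<open>\<mu> i y - \<mu> k y\<close>, which is nonzero
  for a suitable \<open>y\<close>.
\<close>

lemma characters_independent:
  fixes \<mu> :: "'i \<Rightarrow> 'm::monoid_mult \<Rightarrow> 'k::field"
  assumes "distinct_characters I \<mu>" and "\<And>x. (\<Sum>i\<in>I. c i * \<mu> i x) = 0" and "i \<in> I"
  shows "c i = 0"
proof -
  have "finite I" using assms(1) by (simp add: distinct_characters_def)
  then show ?thesis using assms
  proof (induction I arbitrary: c i rule: finite_induct)
    case empty
    then show ?case by simp
  next
    case (insert k I)
    have chI: "distinct_characters I \<mu>"
      and mult: "\<And>j x y. j \<in> insert k I \<Longrightarrow> \<mu> j (x * y) = \<mu> j x * \<mu> j y"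
      using insert.prems(1) by (auto simp: distinct_characters_def multiplicative_def)
    have rel: "(\<Sum>j\<in>I. c j * \<mu> j x) = - (c k * \<mu> k x)" for x
      using insert.prems(2)[of x] insert.hyps by (simp add: eq_neg_iff_add_eq_0 add.commute)
    have zero: "c j = 0" if j: "j \<in> I" for j
    proof -
      have "\<mu> j \<noteq> \<mu> k"
        using insert.prems(1) insert.hyps j unfolding distinct_characters_def inj_on_def by blast
      then obtain y where y: "\<mu> j y \<noteq> \<mu> k y" by (auto simp: fun_eq_iff)
      have "(\<Sum>i\<in>I. (c i * (\<mu> i y - \<mu> k y)) * \<mu> i x) = 0" for x
      proof -
        have "(\<Sum>i\<in>I. (c i * (\<mu> i y - \<mu> k y)) * \<mu> i x) =
            (\<Sum>i\<in>I. c i * \<mu> i (x * y)) - \<mu> k y * (\<Sum>i\<in>I. c i * \<mu> i x)"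
          unfolding sum_distrib_left sum_subtractf[symmetric]
          by (rule sum.cong) (auto simp: mult algebra_simps)
        also have "\<dots> = - (c k * \<mu> k (x * y)) - \<mu> k y * - (c k * \<mu> k x)"
          by (simp only: rel)
        also have "\<dots> = 0" by (simp add: mult)
        finally show ?thesis .
      qed
      from insert.IH[OF chI this j] y show ?thesis by simp
    qed
    moreover have "c k = 0"
    proof -
      have "c k * \<mu> k x = 0" for x
        using rel[of x] zero by simp
      moreover obtain x where "\<mu> k x \<noteq> 0"
        using insert.prems(1) by (auto simp: distinct_characters_def fun_eq_iff)
      ultimately show ?thesis by (metis mult_eq_0_iff)
    qed
    ultimately show ?case using insert.prems(3) by blast
  qed
qed

lemma characters_coefficients_unique:
  fixes \<mu> :: "'i \<Rightarrow> 'm::monoid_mult \<Rightarrow> 'k::field"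
  assumes "distinct_characters I \<mu>"
    and "\<And>x. (\<Sum>i\<in>I. c i * \<mu> i x) = (\<Sum>i\<in>I. d i * \<mu> i x)" and "i \<in> I"
  shows "c i = d i"
proof -
  have "(\<Sum>i\<in>I. (c i - d i) * \<mu> i x) = 0" for x
    using assms(2)[of x] by (simp add: left_diff_distrib sum_subtractf)
  from characters_independent[OF assms(1) this assms(3)] show ?thesis by simp
qed

lemma dependent_family_imp_in_span:
  fixes v :: "'i \<Rightarrow> 'm::monoid_mult \<Rightarrow> 'k::field"
  assumes ch: "distinct_characters I v" and new: "k \<notin> I" and dep: "dependent_family (insert k I) v"
  shows "\<exists>c. \<forall>x. v k x = (\<Sum>i\<in>I. c i * v i x)"
proof -
  have fin: "finite I" using ch by (simp add: distinct_characters_def)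
  obtain J c where J: "J \<subseteq> insert k I" "\<exists>i\<in>J. c i \<noteq> 0" "\<And>x. (\<Sum>i\<in>J. c i * v i x) = 0"
    using dep unfolding dependent_family_def by blast
  define c' where "c' i = (if i \<in> J then c i else 0)" for i
  have rel: "(\<Sum>i\<in>I. c' i * v i x) = - (c' k * v k x)" for x
  proof -
    have "(\<Sum>i\<in>insert k I. c' i * v i x) = (\<Sum>i\<in>J. c i * v i x)"
      using fin J(1) by (intro sum.mono_neutral_cong_right) (auto simp: c'_def)
    then show ?thesis using J(3) fin new by (simp add: eq_neg_iff_add_eq_0 add.commute)
  qed
  have "c' k \<noteq> 0"
  proof
    assume k: "c' k = 0"
    then have "(\<Sum>i\<in>I. c' i * v i x) = 0" for x using rel[of x] by simp
    from characters_independent[OF ch this] have "c' i = 0" if "i \<in> insert k I" for i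
      using k that by blast
    with J(1,2) show False unfolding c'_def by (metis subsetD)
  qed
  then have "v k x = (\<Sum>i\<in>I. (- c' i / c' k) * v i x)" for x
  proof -
    have "(\<Sum>i\<in>I. (- c' i / c' k) * v i x) = - (\<Sum>i\<in>I. c' i * v i x) / c' k"
      by (simp add: sum_negf sum_divide_distrib)
    also have "\<dots> = (c' k * v k x) / c' k" by (simp add: rel)
    finally show ?thesis using \<open>c' k \<noteq> 0\<close> by simp
  qed
  then show ?thesis by (intro exI[of _ "\<lambda>i. - c' i / c' k"] allI)
qed

text \<open>
  With \<open>y = 1\<close> the hypothesis expands \<open>f\<close> in the characters with coefficients \<open>H i 1\<close>; this expansion at
  \<open>x * y\<close> has coefficient \<open>H i 1 * \<mu> i y\<close> at \<open>\<mu> i x\<close>, which independence identifies with \<open>H i y\<close>.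
\<close>

lemma addition_formula_coefficients:
  fixes \<mu> :: "'i \<Rightarrow> 'm::monoid_mult \<Rightarrow> 'k::field"
  assumes ch: "distinct_characters I \<mu>"
    and eq: "\<And>x y. f (x * y) = (\<Sum>i\<in>I. H i y * \<mu> i x)" and i: "i \<in> I"
  shows "H i y = H i 1 * \<mu> i y"
proof (rule characters_coefficients_unique[OF ch _ i])
  fix x
  have "f (x * y) = (\<Sum>i\<in>I. H i 1 * \<mu> i (x * y))"
    using eq[of "x * y" 1] by simp
  also have "\<dots> = (\<Sum>i\<in>I. (H i 1 * \<mu> i y) * \<mu> i x)"
    using ch by (intro sum.cong) (auto simp: distinct_characters_def multiplicative_def)
  finally show "(\<Sum>i\<in>I. H i y * \<mu> i x) = (\<Sum>i\<in>I. (H i 1 * \<mu> i y) * \<mu> i x)"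
    using eq[of x y] by simp
qed

section \<open>Blocks of characters\<close>

text \<open>
  Since \<open>\<beta> i \<noteq> 0\<close>, coefficients can be taken relative to \<open>\<beta> i\<close>; then \<open>hs j\<close> enters the relations of
  block \<open>j\<close> with coefficient one and can be eliminated between two indices.
\<close>

lemma block_relations:
  fixes \<mu> :: "'i \<Rightarrow> 'm::monoid_mult \<Rightarrow> 'k::field"
  assumes A: "finite A" "\<And>j. j \<in> A \<Longrightarrow> finite (B j)" "disjoint_family_on B A"
    and ch: "distinct_characters (\<Union>j\<in>A. B j) \<mu>"
    and \<beta>: "\<And>i. i \<in> (\<Union>j\<in>A. B j) \<Longrightarrow> \<beta> i \<noteq> 0"
    and eq: "\<And>x y. f (x * y) = g x * h y + (\<Sum>j\<in>A. (\<Sum>i\<in>B j. \<beta> i * \<mu> i x) * hs j y)"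
    and g: "\<And>x. g x = (\<Sum>i\<in>(\<Union>j\<in>A. B j). c i * \<mu> i x)"
  shows "\<exists>l p. (\<forall>x. f x = (\<Sum>j\<in>A. \<Sum>i\<in>B j. p i * \<beta> i * \<mu> i x)) \<and>
    (\<forall>x. g x = (\<Sum>j\<in>A. \<Sum>i\<in>B j. l i * \<beta> i * \<mu> i x)) \<and>
    (\<forall>j\<in>A. \<forall>i\<in>B j. \<forall>y. l i * h y + hs j y = p i * \<mu> i y)"
proof -
  let ?I = "\<Union>j\<in>A. B j"
  have blocks: "(\<Sum>i\<in>?I. F i) = (\<Sum>j\<in>A. \<Sum>i\<in>B j. F i)" for F :: "'i \<Rightarrow> 'k"
    using A by (intro sum.UNION_disjoint) (auto simp: disjoint_family_on_def)
  define J where "J i = (THE j. j \<in> A \<and> i \<in> B j)" for i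
  have J: "J i = j" if "j \<in> A" "i \<in> B j" for i j
    unfolding J_def using that A(3) by (intro the_equality) (auto simp: disjoint_family_on_def)
  define l where "l i = c i / \<beta> i" for i
  define H where "H i y = \<beta> i * (l i * h y + hs (J i) y)" for i y
  have g': "g x = (\<Sum>j\<in>A. \<Sum>i\<in>B j. l i * \<beta> i * \<mu> i x)" for x
    unfolding g blocks by (intro sum.cong refl) (use \<beta> in \<open>auto simp: l_def\<close>)
  have "f (x * y) = (\<Sum>i\<in>?I. H i y * \<mu> i x)" for x y
  proof -
    have "f (x * y) = (\<Sum>j\<in>A. (\<Sum>i\<in>B j. l i * \<beta> i * \<mu> i x) * h y + (\<Sum>i\<in>B j. \<beta> i * \<mu> i x) * hs j y)"
      by (simp add: eq g' sum_distrib_right sum.distrib)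
    also have "\<dots> = (\<Sum>j\<in>A. \<Sum>i\<in>B j. H i y * \<mu> i x)"
      unfolding sum_distrib_right sum.distrib[symmetric]
    proof (intro sum.cong refl)
      fix j i assume "j \<in> A" "i \<in> B j"
      then show "l i * \<beta> i * \<mu> i x * h y + \<beta> i * \<mu> i x * hs j y = H i y * \<mu> i x"
        by (simp add: H_def J[of j i] algebra_simps)
    qed
    finally show ?thesis by (simp only: blocks)
  qed
  note H = this addition_formula_coefficients[OF ch this]
  define p where "p i = H i 1 / \<beta> i" for i
  have "f x = (\<Sum>j\<in>A. \<Sum>i\<in>B j. p i * \<beta> i * \<mu> i x)" for x
    using H(1)[of x 1] unfolding blocks mult_1_right
    by (simp, intro sum.cong refl) (use \<beta> in \<open>auto simp: p_def\<close>)
  moreover have "l i * h y + hs j y = p i * \<mu> i y" if "j \<in> A" "i \<in> B j" for i j y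
  proof -
    have i: "i \<in> ?I" using that by blast
    have "\<beta> i * (l i * h y + hs j y) = \<beta> i * (p i * \<mu> i y)"
      using H(2)[OF i, of y] \<beta>[OF i] that by (simp add: H_def J[of j i] p_def)
    then show ?thesis using \<beta>[OF i] by simp
  qed
  ultimately show ?thesis using g' by blast
qed

text \<open>
  A nonzero \<open>p k\<close> with \<open>k\<close> in block \<open>q\<close> makes \<open>h\<close> a combination of characters of block \<open>q\<close> with a nonzero
  coefficient \<open>\<eta> k\<close>. For two indices \<open>i, i'\<close> of another block, comparing coefficients at \<open>k\<close> in
  \<open>(l i - l i') h = p i \<mu> i - p i' \<mu> i'\<close> gives \<open>l i = l i'\<close>, and then \<open>p i = 0\<close>. The last conjunct is the
  same comparison inside block \<open>q\<close>, at an arbitrary index \<open>r\<close>.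
\<close>

lemma concentrated_on_one_block:
  fixes \<mu> :: "'i \<Rightarrow> 'm::monoid_mult \<Rightarrow> 'k::field"
  assumes A: "finite A" "\<And>j. j \<in> A \<Longrightarrow> finite (B j)" "disjoint_family_on B A"
    and two: "\<And>j i. j \<in> A \<Longrightarrow> i \<in> B j \<Longrightarrow> \<exists>i'\<in>B j. i' \<noteq> i"
    and ne: "\<And>j. j \<in> A \<Longrightarrow> B j \<noteq> {}"
    and ch: "distinct_characters (\<Union>j\<in>A. B j) \<mu>"
    and f: "\<And>x. f x = (\<Sum>j\<in>A. \<Sum>i\<in>B j. p i * \<beta> i * \<mu> i x)"
    and g: "\<And>x. g x = (\<Sum>j\<in>A. \<Sum>i\<in>B j. l i * \<beta> i * \<mu> i x)"
    and rel: "\<And>j i y. j \<in> A \<Longrightarrow> i \<in> B j \<Longrightarrow> l i * h y + hs j y = p i * \<mu> i y"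
    and "f \<noteq> (\<lambda>x. 0)"
  shows "\<exists>q\<in>A. \<exists>k\<in>B q. \<exists>\<eta> cs. p k \<noteq> 0 \<and> \<eta> k \<noteq> 0 \<and>
    (\<forall>x. f x = (\<Sum>i\<in>B q. p i * \<beta> i * \<mu> i x)) \<and>
    (\<forall>x. g x = (\<Sum>i\<in>B q. l i * \<beta> i * \<mu> i x) + (\<Sum>j\<in>A - {q}. cs j * (\<Sum>i\<in>B j. \<beta> i * \<mu> i x))) \<and>
    (\<forall>x. h x = (\<Sum>i\<in>B q. \<eta> i * \<mu> i x)) \<and>
    (\<forall>j\<in>A - {q}. \<forall>x. hs j x = - cs j * h x) \<and>
    (\<forall>i\<in>B q. \<forall>i'\<in>B q. \<forall>r\<in>B q.
      (l i - l i') * \<eta> r = (if r = i then p i else 0) - (if r = i' then p i' else 0))"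
proof -
  let ?I = "\<Union>j\<in>A. B j"
  have finI: "finite ?I" using ch by (simp add: distinct_characters_def)
  obtain q k where q: "q \<in> A" and k: "k \<in> B q" and pk: "p k \<noteq> 0"
  proof -
    have "\<exists>q\<in>A. \<exists>k\<in>B q. p k \<noteq> 0"
    proof (rule ccontr)
      assume "\<not> ?thesis"
      then have "f = (\<lambda>x. 0)" by (auto simp: f fun_eq_iff)
      with \<open>f \<noteq> (\<lambda>x. 0)\<close> show False by blast
    qed
    then show ?thesis using that by blast
  qed
  have B_sub: "B j \<subseteq> ?I" if "j \<in> A" for j using that by blast
  define D where "D i i' r = (if r = i then p i else 0) - (if r = i' then p i' else 0)" for i i' r
  have sum_D: "(\<Sum>r\<in>S. D i i' r * \<mu> r x) = p i * \<mu> i x - p i' * \<mu> i' x"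
    if "finite S" "i \<in> S" "i' \<in> S" for S i i' x
    using that by (simp add: D_def left_diff_distrib sum_subtractf if_distrib[of "\<lambda>t. t * _"]
        cong: if_cong)
  have elim: "(l i - l i') * h x = p i * \<mu> i x - p i' * \<mu> i' x"
    if "j \<in> A" "i \<in> B j" "i' \<in> B j" for i i' j x
    unfolding rel[OF that(1,2), symmetric] rel[OF that(1,3), symmetric] by (simp add: algebra_simps)
  obtain k' where k': "k' \<in> B q" "k' \<noteq> k" using two[OF q k] by blast
  have kI: "k \<in> ?I" and k'I: "k' \<in> ?I" using q k k' by auto
  have lk: "l k \<noteq> l k'"
  proof
    assume "l k = l k'"
    then have "(\<Sum>r\<in>?I. D k k' r * \<mu> r x) = 0" for x
      using elim[OF q k k'(1), of x] sum_D[OF finI kI k'I, of x] by simp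
    from characters_independent[OF ch this kI] pk k'(2) show False by (simp add: D_def)
  qed
  define \<eta> where "\<eta> r = D k k' r / (l k - l k')" for r
  have h_on: "h x = (\<Sum>r\<in>S. \<eta> r * \<mu> r x)" if "finite S" "k \<in> S" "k' \<in> S" for S x
  proof -
    have "(\<Sum>r\<in>S. \<eta> r * \<mu> r x) = (\<Sum>r\<in>S. D k k' r * \<mu> r x) / (l k - l k')"
      by (simp add: \<eta>_def sum_divide_distrib)
    also have "\<dots> = h x"
      using elim[OF q k k'(1), of x] lk unfolding sum_D[OF that] by (simp add: divide_eq_eq mult.commute)
    finally show ?thesis by simp
  qed
  have \<eta>k: "\<eta> k \<noteq> 0" using pk lk k'(2) by (simp add: \<eta>_def D_def)
  have coeff: "(l i - l i') * \<eta> r = D i i' r"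
    if "j \<in> A" "i \<in> B j" "i' \<in> B j" "r \<in> ?I" for i i' j r
  proof (rule characters_coefficients_unique[OF ch _ that(4)])
    fix x
    have "(\<Sum>r\<in>?I. ((l i - l i') * \<eta> r) * \<mu> r x) = (l i - l i') * h x"
      by (simp add: h_on[OF finI kI k'I] sum_distrib_left mult.assoc)
    also have "\<dots> = (\<Sum>r\<in>?I. D i i' r * \<mu> r x)"
      using that by (subst sum_D[OF finI]) (auto simp: elim[OF that(1-3)])
    finally show "(\<Sum>r\<in>?I. ((l i - l i') * \<eta> r) * \<mu> r x) = (\<Sum>r\<in>?I. D i i' r * \<mu> r x)" .
  qed
  have other_l: "l i = l i'" if j: "j \<in> A - {q}" "i \<in> B j" "i' \<in> B j" for i i' j
  proof -
    have "k \<notin> B j" using A(3) j(1) q k by (auto simp: disjoint_family_on_def)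
    then have "k \<noteq> i" "k \<noteq> i'" using j by auto
    then show ?thesis using coeff[of j i i' k] j kI \<eta>k by (simp add: D_def)
  qed
  have other_p: "p i = 0" if j: "j \<in> A - {q}" "i \<in> B j" for i j
  proof -
    obtain i' where "i' \<in> B j" "i' \<noteq> i" using two j by blast
    then show ?thesis using coeff[of j i i' i] other_l[OF j, of i'] j by (force simp: D_def)
  qed
  define cs where "cs j = l (SOME i. i \<in> B j)" for j
  have cs: "l i = cs j" if "j \<in> A - {q}" "i \<in> B j" for i j
    unfolding cs_def using that by (intro other_l[OF that] someI)
  have "f x = (\<Sum>i\<in>B q. p i * \<beta> i * \<mu> i x)" for x
    unfolding f by (subst sum.remove[OF A(1) q]) (simp add: other_p)
  moreover have "g x = (\<Sum>i\<in>B q. l i * \<beta> i * \<mu> i x) + (\<Sum>j\<in>A - {q}. cs j * (\<Sum>i\<in>B j. \<beta> i * \<mu> i x))" for x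
    unfolding g by (subst sum.remove[OF A(1) q]) (simp add: cs sum_distrib_left mult.assoc)
  moreover have "hs j x = - cs j * h x" if j: "j \<in> A - {q}" for j x
  proof -
    obtain i where i: "i \<in> B j" using ne j by blast
    then show ?thesis
      using rel[of j i x] j by (simp add: other_p[OF j i] cs[OF j i] add_eq_0_iff)
  qed
  moreover have "h x = (\<Sum>i\<in>B q. \<eta> i * \<mu> i x)" for x
    using h_on[OF A(2)[OF q] k k'(1)] .
  ultimately show ?thesis
    using q k pk \<eta>k coeff[OF q] B_sub[OF q] unfolding D_def by blast
qed

section \<open>Consecutive intervals\<close>

lemma consecutive_intervals_mono:
  fixes ni mi :: "nat \<Rightarrow> nat"
  assumes step: "\<forall>j\<in>{1..n-1}. ni (j + 1) = mi j + 1" and ne: "\<forall>j\<in>{1..n}. ni j \<le> mi j"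
    and "1 \<le> j" "j < j'" "j' \<le> n"
  shows "mi j < ni j'"
proof -
  have "Suc j \<le> j'" using \<open>j < j'\<close> by simp
  then show ?thesis using \<open>j' \<le> n\<close>
  proof (induction j' rule: dec_induct)
    case base
    then show ?case using step \<open>1 \<le> j\<close> by fastforce
  next
    case (step j')
    have "mi j < ni j'" using step by simp
    also have "\<dots> \<le> mi j'" using ne step.hyps step.prems by simp
    also have "\<dots> < ni (Suc j')" using assms(1) step.hyps step.prems by fastforce
    finally show ?case .
  qed
qed

lemma consecutive_intervals_disjoint:
  fixes ni mi :: "nat \<Rightarrow> nat"
  assumes "\<forall>j\<in>{1..n-1}. ni (j + 1) = mi j + 1" and "\<forall>j\<in>{1..n}. ni j \<le> mi j"
  shows "disjoint_family_on (\<lambda>j. {ni j..mi j}) {1..n}"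
proof -
  have "{ni j..mi j} \<inter> {ni j'..mi j'} = {}" if "j \<in> {1..n}" "j' \<in> {1..n}" "j < j'" for j j'
    using consecutive_intervals_mono[OF assms, of j j'] that by auto
  then show ?thesis
    unfolding disjoint_family_on_def by (metis Int_commute linorder_neqE_nat)
qed

lemma consecutive_intervals_cover:
  fixes ni mi :: "nat \<Rightarrow> nat"
  assumes "\<forall>j\<in>{1..n-1}. ni (j + 1) = mi j + 1" and ne: "\<forall>j\<in>{1..n}. ni j \<le> mi j" and "1 \<le> n"
  shows "(\<Union>j\<in>{1..n}. {ni j..mi j}) = {ni 1..mi n}"
proof -
  have "ni 1 \<le> mi t \<and> (\<Union>j\<in>{1..t}. {ni j..mi j}) = {ni 1..mi t}" if "1 \<le> t" "t \<le> n" for t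
    using that
  proof (induction t rule: dec_induct)
    case base
    then show ?case using ne by simp
  next
    case (step t)
    have eq: "ni (Suc t) = Suc (mi t)" using assms(1) step.hyps step.prems by fastforce
    have le: "ni (Suc t) \<le> mi (Suc t)" using ne step.prems by simp
    have "{1..Suc t} = insert (Suc t) {1..t}" by auto
    then have "(\<Union>j\<in>{1..Suc t}. {ni j..mi j}) = {ni 1..mi t} \<union> {Suc (mi t)..mi (Suc t)}"
      using step eq by (auto simp del: UN_simps)
    also have "\<dots> = {ni 1..mi (Suc t)}" using step eq le by auto
    finally show ?case using step eq le by simp
  qed
  then show ?thesis using \<open>1 \<le> n\<close> by blast
qed

section \<open>The two families of solutions\<close>

theorem proposition2p5:
  fixes f g h :: "'m::monoid_mult \<Rightarrow> 'k::field"
    and hs gs :: "nat \<Rightarrow> 'm \<Rightarrow> 'k"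
    and \<mu> :: "nat \<Rightarrow> 'm \<Rightarrow> 'k"
    and \<beta> :: "nat \<Rightarrow> 'k"
    and n m :: nat
    and ni mi :: "nat \<Rightarrow> nat"
  assumes "n \<ge> 2"
    and "\<forall>i\<in>{1..m}. multiplicative (\<mu> i) \<and> \<mu> i \<noteq> (\<lambda>x. 0)"
    and "inj_on \<mu> {1..m}"
    and "\<forall>i\<in>{1..m}. \<beta> i \<noteq> 0"
    and "ni 1 = 1"
    and "\<forall>j\<in>{1..n-1}. ni (j + 1) = mi j + 1"
    and "mi n = m"
    and "\<forall>j\<in>{1..n}. ni j + 1 \<le> mi j"
    and "\<forall>j\<in>{1..n}. gs j = (\<lambda>x. \<Sum>i=ni j..mi j. \<beta> i * \<mu> i x)"
    and "\<forall>x y. f (x * y) = g x * h y + (\<Sum>j=1..n. gs j x * hs j y)"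
    and "f \<noteq> (\<lambda>x. 0)"
    and "dependent_family {0..m} (\<lambda>i. if i = 0 then g else \<mu> i)"
  shows "\<exists>!q. q \<in> {1..n} \<and>
    (\<exists>a b c d :: 'k. \<exists>cs :: nat \<Rightarrow> 'k. c \<noteq> d \<and> (a, b) \<noteq> (0, 0) \<and>
      (mi q = ni q + 1 \<longrightarrow>
         f = (\<lambda>x. (d - c) * (b * \<beta> (ni q) * \<mu> (ni q) x - a * \<beta> (mi q) * \<mu> (mi q) x)) \<and>
         g = (\<lambda>x. d * \<beta> (ni q) * \<mu> (ni q) x + c * \<beta> (mi q) * \<mu> (mi q) x
                   + (\<Sum>j\<in>{1..n} - {q}. cs j * gs j x)) \<and>
         h = (\<lambda>x. a * \<mu> (mi q) x + b * \<mu> (ni q) x) \<and>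
         hs q = (\<lambda>x. - d * a * \<mu> (mi q) x - c * b * \<mu> (ni q) x) \<and>
         (\<forall>j\<in>{1..n} - {q}. hs j = (\<lambda>x. - cs j * a * \<mu> (mi q) x - cs j * b * \<mu> (ni q) x))) \<and>
      (mi q \<ge> ni q + 2 \<longrightarrow>
         a \<noteq> 0 \<and>
         (\<exists>k\<in>{ni q..mi q}.
            f = (\<lambda>x. a * (c - d) * \<beta> k * \<mu> k x) \<and>
            g = (\<lambda>x. d * gs q x + (c - d) * \<beta> k * \<mu> k x
                      + (\<Sum>j\<in>{1..n} - {q}. cs j * gs j x)) \<and>
            h = (\<lambda>x. a * \<mu> k x) \<and>
            hs q = (\<lambda>x. - d * a * \<mu> k x) \<and>
            (\<forall>j\<in>{1..n} - {q}. hs j = (\<lambda>x. - cs j * a * \<mu> k x)))))"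
proof -
  let ?B = "\<lambda>j. {ni j..mi j}"
  have le: "\<forall>j\<in>{1..n}. ni j \<le> mi j" using assms(8) by auto
  have cover: "(\<Union>j\<in>{1..n}. ?B j) = {1..m}"
    using consecutive_intervals_cover[OF assms(6) le] assms(1,5,7) by simp
  have disj: "disjoint_family_on ?B {1..n}"
    by (rule consecutive_intervals_disjoint[OF assms(6) le])
  have ch: "distinct_characters {1..m} \<mu>"
    using assms(2,3) by (simp add: distinct_characters_def)
  let ?v = "\<lambda>i. if i = 0 then g else \<mu> i"
  have v: "?v i = \<mu> i" if "i \<in> {1..m}" for i using that by simp
  have "inj_on ?v {1..m} = inj_on \<mu> {1..m}" by (rule inj_on_cong) (rule v)
  then have inj: "inj_on ?v {1..m}" using assms(3) by (rule iffD2)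
  have "multiplicative (?v i) \<and> ?v i \<noteq> (\<lambda>x. 0)" if i: "i \<in> {1..m}" for i
    unfolding v[OF i] using assms(2) i by (rule bspec)
  then have chv: "distinct_characters {1..m} ?v"
    unfolding distinct_characters_def using inj by (intro conjI ballI) (rule finite_atLeastAtMost | blast)+
  have "insert 0 {1..m} = {0..m}" by auto
  then have dep: "dependent_family (insert 0 {1..m}) ?v" using assms(12) by (simp only:)
  have "\<exists>c. \<forall>x. ?v 0 x = (\<Sum>i\<in>{1..m}. c i * ?v i x)"
    by (rule dependent_family_imp_in_span[OF chv _ dep]) simp
  then obtain c where "\<forall>x. ?v 0 x = (\<Sum>i\<in>{1..m}. c i * ?v i x)" by blast
  then have c: "g x = (\<Sum>i\<in>(\<Union>j\<in>{1..n}. ?B j). c i * \<mu> i x)" for x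
    unfolding cover by simp
  have eq: "f (x * y) = g x * h y + (\<Sum>j\<in>{1..n}. (\<Sum>i\<in>?B j. \<beta> i * \<mu> i x) * hs j y)" for x y
    using assms(9,10) by simp
  have "\<exists>l p. (\<forall>x. f x = (\<Sum>j\<in>{1..n}. \<Sum>i\<in>?B j. p i * \<beta> i * \<mu> i x)) \<and>
    (\<forall>x. g x = (\<Sum>j\<in>{1..n}. \<Sum>i\<in>?B j. l i * \<beta> i * \<mu> i x)) \<and>
    (\<forall>j\<in>{1..n}. \<forall>i\<in>?B j. \<forall>y. l i * h y + hs j y = p i * \<mu> i y)"
  proof (rule block_relations[where g = g and c = c])
    show "distinct_characters (\<Union>j\<in>{1..n}. ?B j) \<mu>" unfolding cover by (rule ch)
    show "\<beta> i \<noteq> 0" if "i \<in> (\<Union>j\<in>{1..n}. ?B j)" for i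
      using that assms(4) unfolding cover by blast
  qed (rule finite_atLeastAtMost disj eq c)+
  then obtain l p where f: "\<And>x. f x = (\<Sum>j\<in>{1..n}. \<Sum>i\<in>?B j. p i * \<beta> i * \<mu> i x)"
    and g: "\<And>x. g x = (\<Sum>j\<in>{1..n}. \<Sum>i\<in>?B j. l i * \<beta> i * \<mu> i x)"
    and rel: "\<And>j i y. j \<in> {1..n} \<Longrightarrow> i \<in> ?B j \<Longrightarrow> l i * h y + hs j y = p i * \<mu> i y"
    by blast
  have lt: "ni j < mi j" if "j \<in> {1..n}" for j using bspec[OF assms(8) that] by simp
  have two: "\<exists>i'\<in>?B j. i' \<noteq> i" if "j \<in> {1..n}" for i j
  proof (cases "i = ni j")
    case True
    then show ?thesis using lt[OF that] by (intro bexI[of _ "mi j"]) auto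
  next
    case False
    then show ?thesis using lt[OF that] by (intro bexI[of _ "ni j"]) auto
  qed
  have "\<exists>q\<in>{1..n}. \<exists>k\<in>?B q. \<exists>\<eta> cs. p k \<noteq> 0 \<and> \<eta> k \<noteq> 0 \<and>
    (\<forall>x. f x = (\<Sum>i\<in>?B q. p i * \<beta> i * \<mu> i x)) \<and>
    (\<forall>x. g x = (\<Sum>i\<in>?B q. l i * \<beta> i * \<mu> i x) + (\<Sum>j\<in>{1..n} - {q}. cs j * (\<Sum>i\<in>?B j. \<beta> i * \<mu> i x))) \<and>
    (\<forall>x. h x = (\<Sum>i\<in>?B q. \<eta> i * \<mu> i x)) \<and>
    (\<forall>j\<in>{1..n} - {q}. \<forall>x. hs j x = - cs j * h x) \<and>
    (\<forall>i\<in>?B q. \<forall>i'\<in>?B q. \<forall>r\<in>?B q.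
      (l i - l i') * \<eta> r = (if r = i then p i else 0) - (if r = i' then p i' else 0))"
  proof (rule concentrated_on_one_block)
    show "distinct_characters (\<Union>j\<in>{1..n}. ?B j) \<mu>" unfolding cover by (rule ch)
    show "?B j \<noteq> {}" if "j \<in> {1..n}" for j using lt[OF that] by simp
    show "\<exists>i'\<in>?B j. i' \<noteq> i" if "j \<in> {1..n}" for i j using two that .
  qed (rule finite_atLeastAtMost disj f g rel assms(11); assumption)+
  then obtain q k \<eta> cs where q: "q \<in> {1..n}" and k: "k \<in> ?B q" and pk: "p k \<noteq> 0" and \<eta>k: "\<eta> k \<noteq> 0"
    and fq: "\<And>x. f x = (\<Sum>i\<in>?B q. p i * \<beta> i * \<mu> i x)"
    and gq: "\<And>x. g x = (\<Sum>i\<in>?B q. l i * \<beta> i * \<mu> i x)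
      + (\<Sum>j\<in>{1..n} - {q}. cs j * (\<Sum>i\<in>?B j. \<beta> i * \<mu> i x))"
    and hq: "\<And>x. h x = (\<Sum>i\<in>?B q. \<eta> i * \<mu> i x)"
    and hs: "\<And>j x. j \<in> {1..n} - {q} \<Longrightarrow> hs j x = - cs j * h x"
    and coeff: "\<And>i i' r. i \<in> ?B q \<Longrightarrow> i' \<in> ?B q \<Longrightarrow> r \<in> ?B q \<Longrightarrow>
      (l i - l i') * \<eta> r = (if r = i then p i else 0) - (if r = i' then p i' else 0)"
    by blast
  have gs: "(\<Sum>j\<in>{1..n} - {q}. cs j * (\<Sum>i\<in>?B j. \<beta> i * \<mu> i x)) = (\<Sum>j\<in>{1..n} - {q}. cs j * gs j x)" for x
    using assms(9) by (intro sum.cong) auto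
  have hsq: "hs q x = p i * \<mu> i x - l i * h x" if "i \<in> ?B q" for i x
    using rel[OF q that, of x] by (simp add: algebra_simps)
  \<comment> \<open>The coordinate of \<open>h\<close> at \<open>\<mu> k\<close> is nonzero, so any block spanning \<open>h\<close> contains \<open>k\<close>.\<close>
  have spanned: "q' = q" if q': "q' \<in> {1..n}" and span: "\<exists>\<theta>. \<forall>x. h x = (\<Sum>i\<in>?B q'. \<theta> i * \<mu> i x)" for q'
  proof (rule ccontr)
    assume "q' \<noteq> q"
    then have k': "k \<notin> ?B q'" using disj q q' k unfolding disjoint_family_on_def by blast
    obtain \<theta> where \<theta>: "\<And>x. h x = (\<Sum>i\<in>?B q'. \<theta> i * \<mu> i x)" using span by blast
    have extend: "(\<Sum>i\<in>{1..m}. (if i \<in> ?B j then \<zeta> i else 0) * \<mu> i x) = (\<Sum>i\<in>?B j. \<zeta> i * \<mu> i x)"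
      if "j \<in> {1..n}" for j \<zeta> x
    proof (rule sum.mono_neutral_cong_right)
      show "?B j \<subseteq> {1..m}" unfolding cover[symmetric] using that by blast
    qed auto
    have km: "k \<in> {1..m}" using k q cover by blast
    have "(if k \<in> ?B q then \<eta> k else 0) = (if k \<in> ?B q' then \<theta> k else 0)"
      by (rule characters_coefficients_unique[OF ch _ km, where c = "\<lambda>i. if i \<in> ?B q then \<eta> i else 0"
            and d = "\<lambda>i. if i \<in> ?B q' then \<theta> i else 0"])
        (simp only: extend[OF q] extend[OF q'] \<theta>[symmetric] hq[symmetric])
    with \<eta>k show False by (simp only: k k' if_True if_False)
  qed
  show ?thesis
  proof (rule ex1I[of _ q], goal_cases)
    case 1
    show ?case
    proof (cases "mi q = ni q + 1")
      case True
      let ?n = "ni q" and ?m = "mi q"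
      have B: "?B q = {?n, ?m}" and nm: "?n \<noteq> ?m" using True by auto
      have pn: "p ?n = (l ?n - l ?m) * \<eta> ?n" and pm: "p ?m = (l ?m - l ?n) * \<eta> ?m"
        using coeff[of ?n ?m ?n] coeff[of ?m ?n ?m] B nm by auto
      have hx: "h x = \<eta> ?m * \<mu> ?m x + \<eta> ?n * \<mu> ?n x" for x
        unfolding hq B using nm by simp
      have cd: "l ?m \<noteq> l ?n" using pk k pn pm B by auto
      have ab: "(\<eta> ?m, \<eta> ?n) \<noteq> (0, 0)" using \<eta>k k B by auto
      have "f = (\<lambda>x. (l ?n - l ?m) * (\<eta> ?n * \<beta> ?n * \<mu> ?n x - \<eta> ?m * \<beta> ?m * \<mu> ?m x))"
        unfolding fun_eq_iff fq B using nm by (simp add: pn pm algebra_simps)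
      moreover have "g = (\<lambda>x. l ?n * \<beta> ?n * \<mu> ?n x + l ?m * \<beta> ?m * \<mu> ?m x
          + (\<Sum>j\<in>{1..n} - {q}. cs j * gs j x))"
        unfolding fun_eq_iff gq gs B using nm by simp
      moreover have "hs q = (\<lambda>x. - l ?n * \<eta> ?m * \<mu> ?m x - l ?m * \<eta> ?n * \<mu> ?n x)"
        using hsq[of ?n] B by (simp add: fun_eq_iff hx pn algebra_simps)
      moreover have "\<forall>j\<in>{1..n} - {q}.
          hs j = (\<lambda>x. - cs j * \<eta> ?m * \<mu> ?m x - cs j * \<eta> ?n * \<mu> ?n x)"
        by (simp add: fun_eq_iff hs hx algebra_simps)
      moreover have "h = (\<lambda>x. \<eta> ?m * \<mu> ?m x + \<eta> ?n * \<mu> ?n x)" using hx by blast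
      moreover have "\<not> mi q \<ge> ni q + 2" using True by simp
      ultimately show ?thesis
        using q cd ab
        by (intro conjI exI[of _ "\<eta> ?m"] exI[of _ "\<eta> ?n"] exI[of _ "l ?m"] exI[of _ "l ?n"] exI[of _ cs])
          blast+
    next
      case False
      have ge: "mi q \<ge> ni q + 2" using False lt[OF q] by simp
      obtain k' where k': "k' \<in> ?B q" "k' \<noteq> k" using two[OF q] by blast
      have lk: "l k \<noteq> l i" if "i \<in> ?B q" "i \<noteq> k" for i
        using coeff[OF k that(1) k] pk that(2) by auto
      \<comment> \<open>With a third index \<open>i\<close>, the pair \<open>k, i\<close> already spans \<open>h\<close>, leaving no coordinate at \<open>r\<close>.\<close>
      have \<eta>0: "\<eta> r = 0" if r: "r \<in> ?B q" "r \<noteq> k" for r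
      proof -
        have "card (?B q - {k, r}) = Suc (mi q) - ni q - 2"
          using k r by (simp add: card_Diff_subset)
        then have "?B q - {k, r} \<noteq> {}" using ge by (intro notI) simp
        then obtain i where i: "i \<in> ?B q" "i \<noteq> k" "i \<noteq> r" by blast
        show ?thesis using coeff[OF k i(1) r(1)] lk[OF i(1,2)] r(2) i(3) by simp
      qed
      have li: "l i = l k'" and pi: "p i = 0" if i: "i \<in> ?B q" "i \<noteq> k" for i
      proof -
        show "l i = l k'" using coeff[OF i(1) k'(1) k] \<eta>k i k' by auto
        show "p i = 0" using coeff[OF i(1) k i(1)] i \<eta>0[OF i] by simp
      qed
      have hx: "h x = \<eta> k * \<mu> k x" for x
        unfolding hq by (subst sum.remove[OF _ k]) (simp_all add: \<eta>0)
      have pk': "p k = (l k - l k') * \<eta> k" using coeff[OF k k'(1) k] k'(2) by simp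
      have "f = (\<lambda>x. \<eta> k * (l k - l k') * \<beta> k * \<mu> k x)"
        unfolding fun_eq_iff fq by (subst sum.remove[OF _ k]) (simp_all add: pi pk')
      moreover have "g = (\<lambda>x. l k' * gs q x + (l k - l k') * \<beta> k * \<mu> k x
          + (\<Sum>j\<in>{1..n} - {q}. cs j * gs j x))"
      proof -
        have "(\<Sum>i\<in>?B q. l i * \<beta> i * \<mu> i x) = l k' * gs q x + (l k - l k') * \<beta> k * \<mu> k x" for x
        proof -
          have "gs q x = \<beta> k * \<mu> k x + (\<Sum>i\<in>?B q - {k}. \<beta> i * \<mu> i x)"
            using assms(9) q by (simp add: sum.remove[OF _ k])
          moreover have "(\<Sum>i\<in>?B q. l i * \<beta> i * \<mu> i x)
              = l k * \<beta> k * \<mu> k x + l k' * (\<Sum>i\<in>?B q - {k}. \<beta> i * \<mu> i x)"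
            by (subst sum.remove[OF _ k]) (simp_all add: li sum_distrib_left mult.assoc)
          ultimately show ?thesis by (simp add: algebra_simps)
        qed
        then show ?thesis unfolding fun_eq_iff gq gs by simp
      qed
      moreover have "hs q = (\<lambda>x. - l k' * \<eta> k * \<mu> k x)"
        using hsq[OF k'(1)] by (simp add: fun_eq_iff hx pi[OF k'])
      moreover have "\<forall>j\<in>{1..n} - {q}. hs j = (\<lambda>x. - cs j * \<eta> k * \<mu> k x)"
        by (simp add: fun_eq_iff hs hx)
      moreover have "h = (\<lambda>x. \<eta> k * \<mu> k x)" using hx by blast
      moreover have "(\<eta> k, 0) \<noteq> (0, 0 :: 'k)" using \<eta>k by simp
      ultimately show ?thesis
        using q \<eta>k lk[OF k'] k False
        by (intro conjI exI[of _ "\<eta> k"] exI[of _ "0 :: 'k"] exI[of _ "l k"] exI[of _ "l k'"] exI[of _ cs])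
          blast+
    qed
  next
    case (2 q')
    then have q': "q' \<in> {1..n}" by blast
    let ?n = "ni q'" and ?m = "mi q'"
    have "?m = ?n + 1 \<or> ?m \<ge> ?n + 2" using lt[OF q'] by linarith
    with 2 consider a b where "?m = ?n + 1" "h = (\<lambda>x. a * \<mu> ?m x + b * \<mu> ?n x)"
      | a i where "i \<in> ?B q'" "h = (\<lambda>x. a * \<mu> i x)"
      by blast
    then have "\<exists>\<theta>. \<forall>x. h x = (\<Sum>i\<in>?B q'. \<theta> i * \<mu> i x)"
    proof cases
      case (1 a b)
      have "?B q' = {?n, ?m}" "?n \<noteq> ?m" using 1(1) by auto
      then show ?thesis
        by (intro exI[of _ "\<lambda>i. if i = ?n then b else a"]) (simp add: 1(2) add.commute)
    next
      case (2 a i)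
      then show ?thesis
        by (intro exI[of _ "\<lambda>r. if r = i then a else 0"])
          (simp add: if_distrib[of "\<lambda>t. t * _"] cong: if_cong)
    qed
    with q' show ?case by (rule spanned)
  qed
qed

end
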